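(* Let $a,b\ge1$ be odd integers and let $n=3k-1$ for some integer $k\ge2$. Then the Horadam cube $\Pi^{a,b}_n$ is Hamiltonian.
   Context: For integers $a,b\ge1$ and $n\ge 0$, $\mathcal S^{a,b}_n$ is the set of all strings of length $n$ over the alphabet $\{0,1,\dots,a+b-1\}$ in which every letter from $\{a,\dots,a+b-1\}$ appears only immediately after a letter $0$. The Horadam cube $\Pi^{a,b}_n$ is the simple graph with vertex set $\mathcal S^{a,b}_n$ in which $x_1\cdots x_n$ and $y_1\cdots y_n$ are adjacent if and only if $\sum_{i=1}^n|x_i-y_i|=1$. A graph is Hamiltonian if it contains a cycle visiting each vertex exactly once. *)

theory Defs
  imports "Graph_Theory.Graph_Theory"
begin

definition horadam_strings :: "nat \<Rightarrow> nat \<Rightarrow> nat \<Rightarrow> nat list set" where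
  "horadam_strings a b n =
    {x. length x = n \<and> set x \<subseteq> {0..<a + b} \<and>
        (\<forall>i<n. x ! i \<in> {a..<a + b} \<longrightarrow> 0 < i \<and> x ! (i - 1) = 0)}"

(* Undirected graphs are represented as symmetric digraphs: an edge is a pair of opposite arcs. *)
definition horadam_cube :: "nat \<Rightarrow> nat \<Rightarrow> nat \<Rightarrow> nat list pair_pre_digraph" where
  "horadam_cube a b n =
    \<lparr> pverts = horadam_strings a b n,
      parcs = {(x, y). x \<in> horadam_strings a b n \<and> y \<in> horadam_strings a b n \<and>
                       (\<Sum>i<n. \<bar>int (x ! i) - int (y ! i)\<bar>) = 1} \<rparr>"

(* In a symmetric digraph every edge yields a directed cycle u, v, u; the bound on the length
   rules this out, since a cycle of a simple graph has at least three edges. The library's notion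
   of cycle already forbids repeated vertices, so it remains to require that all are visited. *)
definition hamiltonian :: "'a pair_pre_digraph \<Rightarrow> bool" where
  "hamiltonian G \<longleftrightarrow>
    (\<exists>p. pre_digraph.cycle (with_proj G) p \<and> 3 \<le> length p \<and> fst ` set p = pverts G)"

lemma finite_horadam_strings: "finite (horadam_strings a b n)"
  by (rule finite_subset[OF _ finite_lists_length_eq[of "{0..<a + b}" n]])
    (auto simp: horadam_strings_def)

lemma pair_graph_horadam_cube: "pair_graph (horadam_cube a b n)"
proof
  show "finite (parcs (horadam_cube a b n))"
    by (rule finite_subset[of _ "horadam_strings a b n \<times> horadam_strings a b n"])
      (auto simp: horadam_cube_def finite_horadam_strings)
  show "symmetric (with_proj (horadam_cube a b n))"
    by (auto simp: symmetric_def horadam_cube_def sym_def abs_minus_commute)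
qed (auto simp: horadam_cube_def finite_horadam_strings)

end

theory Submission
  imports Defs
begin

text \<open>
  Let \<open>x\<^sub>1, \<dots>, x\<^sub>L\<close> be a Hamiltonian path of the cube of dimension \<open>n\<close> with \<open>L\<close> even. The strings of
  length \<open>n + 3\<close> extending \<open>x\<^sub>i\<close> form a fiber that depends only on whether \<open>x\<^sub>i\<close> ends in 0, and in both
  cases the fiber has a Hamiltonian path, with a common first, second and last suffix. The first
  vertices of all fibers form a copy of \<open>x\<^sub>1, \<dots>, x\<^sub>L\<close>; returning from \<open>x\<^sub>L\<close> to \<open>x\<^sub>1\<close> through the rest of
  the fibers, traversed alternately up and down, gives a Hamiltonian cycle because \<open>L\<close> is even.
  The parity of the letter sum is a 2-colouring, so the cycle again has even length and the step
  can be iterated from \<open>n = 2\<close>, where only an even Hamiltonian path (and no cycle) exists.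
\<close>

section \<open>Boustrophedon lists\<close>

text \<open>The alternation is pushed into the function argument, so no index is carried along;
  inductions therefore run with \<open>F\<close> arbitrary.\<close>

fun snake :: "('a \<Rightarrow> 'b list) \<Rightarrow> 'a list \<Rightarrow> 'b list" where
  "snake F [] = []"
| "snake F (x # xs) = F x @ snake (\<lambda>y. rev (F y)) xs"

lemma set_snake [simp]: "set (snake F xs) = (\<Union>x\<in>set xs. set (F x))"
  by (induction xs arbitrary: F) auto

lemma snake_eq_Nil_iff: "snake F xs = [] \<longleftrightarrow> (\<forall>x\<in>set xs. F x = [])"
  by (induction xs arbitrary: F) auto

lemma hd_snake: "xs \<noteq> [] \<Longrightarrow> F (hd xs) \<noteq> [] \<Longrightarrow> hd (snake F xs) = hd (F (hd xs))"
  by (cases xs) auto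

text \<open>Forward and backward blocks alternate, so the parity of the number of blocks decides at
  which end of the last block the list stops.\<close>

lemma last_snake:
  assumes "xs \<noteq> []" "\<forall>x\<in>set xs. F x \<noteq> []"
  shows "last (snake F xs) =
    (if odd (length xs) then last (F (last xs)) else hd (F (last xs)))"
  using assms
proof (induction xs arbitrary: F)
  case (Cons x xs)
  show ?case
  proof (cases "xs = []")
    case False
    with Cons.prems have "snake (\<lambda>y. rev (F y)) xs \<noteq> []"
      by (cases xs) auto
    with Cons.IH[of "\<lambda>y. rev (F y)"] Cons.prems False show ?thesis
      by (auto simp: last_rev hd_rev)
  qed simp
qed simp

lemma distinct_snake:
  assumes "distinct xs" "\<And>x. x \<in> set xs \<Longrightarrow> distinct (F x)"
    and "\<And>x y. x \<in> set xs \<Longrightarrow> y \<in> set xs \<Longrightarrow> x \<noteq> y \<Longrightarrow> set (F x) \<inter> set (F y) = {}"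
  shows "distinct (snake F xs)"
  using assms
proof (induction xs arbitrary: F)
  case (Cons x xs)
  have "distinct (snake (\<lambda>y. rev (F y)) xs)"
    using Cons.prems by (intro Cons.IH) auto
  with Cons.prems show ?case
    by fastforce
qed simp

text \<open>A forward block meets the next at their last elements, a backward one at their heads.
  Assuming both links makes the hypothesis invariant under reversing every block, as the induction
  requires.\<close>

lemma successively_snake:
  assumes "symp R" "\<forall>x\<in>set xs. F x \<noteq> [] \<and> successively R (F x)"
    and "successively (\<lambda>x y. R (hd (F x)) (hd (F y)) \<and> R (last (F x)) (last (F y))) xs"
  shows "successively R (snake F xs)"
  using assms(2,3)
proof (induction xs arbitrary: F)
  case (Cons x xs)
  have rev_R: "(\<lambda>x y. R y x) = R"
    using assms(1) by (auto simp: fun_eq_iff symp_def)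
  have rev: "successively R (rev ys) \<longleftrightarrow> successively R ys" for ys
    unfolding successively_rev rev_R ..
  have "successively R (snake (\<lambda>y. rev (F y)) xs)"
  proof (rule Cons.IH)
    show "\<forall>x\<in>set xs. rev (F x) \<noteq> [] \<and> successively R (rev (F x))"
      using Cons.prems by (auto simp: rev simp del: successively_rev)
    have "successively (\<lambda>x y. R (hd (F x)) (hd (F y)) \<and> R (last (F x)) (last (F y))) xs"
      using Cons.prems by (auto simp: successively_Cons)
    then show "successively (\<lambda>x y. R (hd (rev (F x))) (hd (rev (F y))) \<and>
        R (last (rev (F x))) (last (rev (F y)))) xs"
      by (rule successively_mono) (use Cons.prems in \<open>auto simp: hd_rev last_rev\<close>)
  qed
  moreover have "xs \<noteq> [] \<Longrightarrow> R (last (F x)) (hd (snake (\<lambda>y. rev (F y)) xs))"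
    using Cons.prems by (cases xs) (auto simp: hd_rev)
  ultimately show ?case
    using Cons.prems by (cases "xs = []") (auto simp: successively_append_iff)
qed simp

text \<open>The colour \<open>f\<close> flips at every step, so only the parity of the number of
  steps counts.\<close>

lemma even_length_successively:
  assumes "\<And>x y. R x y \<Longrightarrow> f x \<noteq> (f y :: bool)" "successively R xs" "xs \<noteq> []"
  shows "even (length xs) \<longleftrightarrow> f (hd xs) \<noteq> f (last xs)"
  using assms(2,3)
proof (induction xs)
  case (Cons x xs)
  then show ?case
    using assms(1)[of x "hd xs"] by (cases "xs = []") (auto simp: successively_Cons)
qed simp

section \<open>Adjacency and admissible strings\<close>

text \<open>Recursive form of letterwise distance 1 between strings of equal length, suited to
  splitting off common prefixes and suffixes.\<close>

fun adj :: "nat list \<Rightarrow> nat list \<Rightarrow> bool" where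
  "adj (c # x) (d # y) \<longleftrightarrow> c = d \<and> adj x y \<or> (c = Suc d \<or> d = Suc c) \<and> x = y"
| "adj _ _ \<longleftrightarrow> False"

lemma adj_sym: "adj x y \<Longrightarrow> adj y x"
  by (induction x y rule: adj.induct) auto

lemma symp_adj: "symp adj"
  by (auto simp: symp_def adj_sym)

lemma adj_append_left [simp]: "adj (u @ x) (u @ y) \<longleftrightarrow> adj x y"
  by (induction u) auto

lemma adj_append_right: "adj x y \<Longrightarrow> adj (x @ u) (y @ u)"
  by (induction x y rule: adj.induct) auto

lemma adj_parity: "adj x y \<Longrightarrow> even (sum_list x) \<noteq> even (sum_list y)"
  by (induction x y rule: adj.induct) auto

lemma adj_sum_abs:
  "adj x y \<Longrightarrow> length x = n \<Longrightarrow> length y = n \<Longrightarrow> (\<Sum>i<n. \<bar>int (x ! i) - int (y ! i)\<bar>) = 1"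
proof (induction x y arbitrary: n rule: adj.induct)
  case (1 c x d y)
  then show ?case
    by (cases n) (auto simp: sum.lessThan_Suc_shift simp del: sum.lessThan_Suc)
qed auto

text \<open>The flag records whether the letter preceding the string is 0.\<close>

fun admissible :: "nat \<Rightarrow> nat \<Rightarrow> bool \<Rightarrow> nat list \<Rightarrow> bool" where
  "admissible a b z [] \<longleftrightarrow> True"
| "admissible a b z (c # x) \<longleftrightarrow> c < (if z then a + b else a) \<and> admissible a b (c = 0) x"

lemma admissible_append:
  "x \<noteq> [] \<Longrightarrow>
    admissible a b z (x @ y) \<longleftrightarrow> admissible a b z x \<and> admissible a b (last x = 0) y"
  by (induction x arbitrary: z) auto

lemma admissible_iff:
  "admissible a b z x \<longleftrightarrow> set x \<subseteq> {0..<a + b} \<and>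
    (\<forall>i<length x. a \<le> x ! i \<longrightarrow> (if i = 0 then z else x ! (i - 1) = 0))"
proof (induction x arbitrary: z)
  case (Cons c x)
  show ?case
    unfolding admissible.simps Cons
    by (auto simp: All_less_Suc2 nth_Cons split: nat.splits if_splits)
qed simp

text \<open>With flag \<open>False\<close> these are the vertices of the cube, since a first letter
  is as restricted as one after a nonzero letter; with flag \<open>last x = 0\<close> they are the
  suffixes that may extend a nonempty vertex \<open>x\<close>.\<close>

definition strings :: "nat \<Rightarrow> nat \<Rightarrow> bool \<Rightarrow> nat \<Rightarrow> nat list set" where
  "strings a b z n = {x. length x = n \<and> admissible a b z x}"

lemma horadam_strings_eq: "horadam_strings a b n = strings a b False n"
proof -
  have "(if i = 0 then False else P) \<longleftrightarrow> 0 < i \<and> P" for i :: nat and P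
    by simp
  then show ?thesis
    unfolding horadam_strings_def strings_def admissible_iff
    by (simp only:) (auto simp: subset_iff dest: nth_mem)
qed

definition spanning_path :: "nat list set \<Rightarrow> nat list list \<Rightarrow> bool" where
  "spanning_path S xs \<longleftrightarrow> successively adj xs \<and> distinct xs \<and> set xs = S"

section \<open>From vertex lists to cycles of the library\<close>

lemma pcas_zip: "vs \<noteq> [] \<Longrightarrow> pcas (hd vs) (zip vs (tl vs @ [z])) z"
proof (induction vs)
  case (Cons v vs)
  then show ?case by (cases vs) auto
qed simp

lemma hamiltonianI:
  assumes S: "spanning_path (horadam_strings a b n) vs"
    and closed: "adj (last vs) (hd vs)" and len: "3 \<le> length vs"
  shows "hamiltonian (horadam_cube a b n)"
proof -
  let ?G = "horadam_cube a b n" and ?u = "hd vs"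
  \<comment> \<open>Each vertex is paired with its cyclic successor, the last arc leading back to
    \<open>?u\<close>.\<close>
  let ?p = "zip vs (tl vs @ [?u])"
  have vs: "vs \<noteq> []" "length (tl vs @ [?u]) = length vs" and set_vs: "set vs = pverts ?G"
    using len S by (auto simp: spanning_path_def horadam_cube_def)
  have arcs: "(x, y) \<in> parcs ?G" if "x \<in> set vs" "y \<in> set vs" "adj x y" for x y
    using that adj_sum_abs[of x y n] S
    by (auto simp: horadam_cube_def spanning_path_def horadam_strings_def)
  have "set ?p \<subseteq> parcs ?G"
  proof
    fix e assume "e \<in> set ?p"
    then obtain i where i: "i < length vs" "e = (vs ! i, (tl vs @ [?u]) ! i)"
      using vs by (auto simp: set_zip)
    have "adj (vs ! i) ((tl vs @ [?u]) ! i)"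
    proof (cases "Suc i < length vs")
      case True
      then show ?thesis
        using S by (auto simp: spanning_path_def nth_append nth_tl successively_nth)
    next
      case False
      then have "i = length vs - 1" using i by simp
      then show ?thesis
        using closed vs by (simp add: nth_append last_conv_nth)
    qed
    moreover have "(tl vs @ [?u]) ! i \<in> set vs"
      using i vs nth_mem[of i "tl vs @ [?u]"] by (cases vs) auto
    ultimately show "e \<in> parcs ?G"
      using i by (auto intro: arcs)
  qed
  moreover have "?u \<in> pverts ?G"
    using hd_in_set[OF vs(1)] set_vs by simp
  ultimately have walk: "pre_digraph.awalk (with_proj ?G) ?u ?p ?u"
    using vs pcas_zip[of vs ?u] by (simp add: pre_digraph.awalk_def cas_with_proj_eq)
  have "pre_digraph.awalk_verts (with_proj ?G) ?u ?p = map fst ?p @ [snd (last ?p)]"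
    using vs by (simp add: pre_digraph.awalk_verts_conv)
  also have "\<dots> = vs @ [?u]"
    using vs by (simp add: last_zip)
  \<comment> \<open>Only \<open>?u\<close> occurs twice on the closed walk, and the tail drops its
    first occurrence.\<close>
  finally have "distinct (tl (pre_digraph.awalk_verts (with_proj ?G) ?u ?p))"
    using S vs by (cases vs) (auto simp: spanning_path_def)
  moreover have "?p \<noteq> []"
    using vs by (cases vs) auto
  ultimately have "pre_digraph.cycle (with_proj ?G) ?p"
    unfolding pre_digraph.cycle_def using walk by blast
  moreover have "fst ` set ?p = pverts ?G"
    using vs set_vs by (simp flip: set_map)
  moreover have "3 \<le> length ?p"
    using len vs by simp
  ultimately show ?thesis
    unfolding hamiltonian_def by blast
qed

section \<open>Spanning paths of short strings\<close>

lemma strings_0 [simp]: "strings a b z 0 = {[]}"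
  by (auto simp: strings_def)

lemma Cons_in_strings_Suc [simp]:
  "c # x \<in> strings a b z (Suc n) \<longleftrightarrow>
    c < (if z then a + b else a) \<and> x \<in> strings a b (c = 0) n"
  by (auto simp: strings_def)

lemma in_strings_Suc:
  "x \<in> strings a b z (Suc n) \<longleftrightarrow>
    (\<exists>c y. x = c # y \<and> c < (if z then a + b else a) \<and> y \<in> strings a b (c = 0) n)"
  by (cases x) (auto simp: strings_def)

lemma successively_upt:
  "(\<And>i. m \<le> i \<Longrightarrow> Suc i < n \<Longrightarrow> P i (Suc i)) \<Longrightarrow> successively P [m..<n]"
  by (auto simp: successively_conv_nth)

lemma even_length_path:
  "successively adj xs \<Longrightarrow> xs \<noteq> [] \<Longrightarrow>
    even (length xs) \<longleftrightarrow> even (sum_list (hd xs)) \<noteq> even (sum_list (last xs))"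
  by (rule even_length_successively[OF adj_parity])

text \<open>\<open>A\<close> sweeps the rows with first letter \<open>a - 1\<close> down to 1, and
  row 0 with its \<open>a + b\<close> entries follows. Since \<open>a - 1\<close> is even, a
  nonempty \<open>A\<close> ends at \<open>[1, 0]\<close>, next to \<open>[0, 0]\<close>. The ends
  of \<open>W\<close> have letter sums \<open>a - 1\<close> and \<open>a + b - 1\<close> of
  different parity, so its length is even.\<close>

lemma spanning_path_length_2:
  assumes "odd a" "odd b"
  obtains W where "spanning_path (strings a b False 2) W" "W \<noteq> []" "even (length W)"
    "hd W = [a - 1, 0]"
proof -
  define F where "F = (\<lambda>r. map (\<lambda>c. [r, c]) [0..<a])"
  define A where "A = snake F (rev [1..<a])"
  define W where "W = A @ map (\<lambda>c. [0, c]) [0..<a + b]"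
  have ab: "0 < a" "0 < b"
    using assms by (auto intro: odd_pos)
  have hd_F: "hd (F r) = [r, 0]" and last_F: "last (F r) = [r, a - 1]" and F: "F r \<noteq> []" for r
    using ab by (auto simp: F_def hd_map last_map)
  have adj_F: "successively adj (F r)" for r
    by (auto simp: F_def successively_map intro!: successively_upt)
  have A_empty: "A = [] \<longleftrightarrow> a = 1"
    using ab by (auto simp: A_def snake_eq_Nil_iff F)
  have hd_A: "hd A = [a - 1, 0]" if "a \<noteq> 1"
    using ab that by (auto simp: A_def hd_snake F hd_F hd_rev)
  have last_A: "last A = [1, 0]" if "a \<noteq> 1"
    using ab that assms by (auto simp: A_def last_snake F hd_F last_rev)
  have "successively adj A"
    unfolding A_def
    by (rule successively_snake[OF symp_adj])
       (auto simp: F hd_F last_F adj_F intro!: successively_upt)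
  moreover have "distinct A"
    unfolding A_def by (rule distinct_snake) (auto simp: F_def distinct_map inj_on_def)
  ultimately have "successively adj W" "distinct W"
    using last_A A_empty ab
    by (auto simp: W_def successively_append_iff successively_map hd_map distinct_map inj_on_def
        A_def F_def intro!: successively_upt)
  moreover have "set W = strings a b False 2"
  proof (rule set_eqI)
    fix x
    have "x \<in> strings a b False 2 \<longleftrightarrow> (\<exists>p q. x = [p, q] \<and> p < a \<and> q < (if p = 0 then a + b else a))"
      by (auto simp: numeral_2_eq_2 in_strings_Suc)
    moreover have "x \<in> set W \<longleftrightarrow>
        (\<exists>p q. x = [p, q] \<and> (0 < p \<and> p < a \<and> q < a \<or> p = 0 \<and> q < a + b))"
      by (auto simp: W_def A_def F_def Suc_le_eq image_iff Bex_def)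
    ultimately show "x \<in> set W \<longleftrightarrow> x \<in> strings a b False 2"
      using ab by auto
  qed
  moreover have "W \<noteq> []" "hd W = [a - 1, 0]"
    using ab hd_A A_empty by (auto simp: W_def hd_append hd_map)
  moreover have "last W = [0, a + b - 1]"
    using ab by (auto simp: W_def last_map)
  ultimately show ?thesis
    using assms even_length_path[of W] that[of W] by (auto simp: spanning_path_def)
qed

text \<open>\<open>q\<close>, \<open>h\<close> and \<open>l\<close> are chosen before
  \<open>z\<close>, so that fibers over adjacent strings match at these suffixes even if only one of
  the strings ends in 0.\<close>

lemma spanning_paths_length_3:
  assumes "odd a" "odd b"
  shows "\<exists>q U h l. \<forall>z. spanning_path (strings a b z 3) (q # U z) \<and>
    U z \<noteq> [] \<and> hd (U z) = h \<and> last (U z) = l"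
proof -
  obtain W where W: "spanning_path (strings a b False 2) W" "W \<noteq> []" "even (length W)"
    and hd_W: "hd W = [a - 1, 0]"
    using spanning_path_length_2[OF assms] .
  have ab: "0 < a" "0 < b"
    using assms by (auto intro: odd_pos)
  text \<open>\<open>E\<close> covers the strings with a large middle letter, \<open>D\<close> those remaining ones with first letter
    below \<open>a - 1\<close>. In \<open>T\<close> the path \<open>W\<close> over the letter \<open>a - 1\<close> is widened by columns over the large first
    letters; as \<open>W\<close> has even length, this changes neither end of the path.\<close>
  define e where "e = (\<lambda>s. map (\<lambda>r. [0, s, r]) (rev [0..<a]))"
  define E where "E = snake e (rev [a..<a + b])"
  define D where "D = snake (\<lambda>r. map ((#) r) W) [0..<a - 1]"
  define M where "M = (\<lambda>z w. map (\<lambda>p. p # w) [a - 1..<if z then a + b else a])"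
  define T where "T = (\<lambda>z. snake (M z) W)"
  have hd_e: "hd (e s) = [0, s, a - 1]" and last_e: "last (e s) = [0, s, 0]"
    and e: "e s \<noteq> []" for s
    using ab by (auto simp: e_def hd_map last_map hd_rev last_rev)
  have adj_e: "successively adj (e s)" for s
    by (auto simp: e_def successively_map intro!: successively_upt)
  have E: "E \<noteq> []"
    using ab by (auto simp: E_def snake_eq_Nil_iff e)
  \<comment> \<open>There are \<open>b\<close> columns \<open>e s\<close>, an odd number, so the
    last one, \<open>e a\<close>, runs forward.\<close>
  have last_E: "last E = [0, a, 0]"
    using ab assms by (auto simp: E_def last_snake e last_e last_rev)
  have M: "M z w \<noteq> []" "hd (M z w) = (a - 1) # w" for z w
    using ab by (auto simp: M_def hd_map)
  have last_M: "last (M z w) = (if z then a + b - 1 else a - 1) # w" for z w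
    using ab by (auto simp: M_def last_map)
  have T: "T z \<noteq> []" "hd (T z) = [a - 1, a - 1, 0]" "last (T z) = (a - 1) # last W" for z
    using W hd_W M by (auto simp: T_def snake_eq_Nil_iff hd_snake last_snake)
  have D_empty: "D = [] \<longleftrightarrow> a = 1"
    using ab W by (auto simp: D_def snake_eq_Nil_iff dest: spec[of _ 0])
  have hd_D: "hd D = [0, a - 1, 0]" if "a \<noteq> 1"
    using ab W hd_W that by (auto simp: D_def hd_snake hd_map)
  \<comment> \<open>The number \<open>a - 1\<close> of copies of \<open>W\<close> is even, so the
    last copy runs backward and stops over \<open>hd W\<close>.\<close>
  have last_D: "last D = [a - Suc (Suc 0), a - 1, 0]" if "a \<noteq> 1"
    using ab W hd_W that assms by (auto simp: D_def last_snake hd_map)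
  have adj_W: "successively adj W" and dist_W: "distinct W" and set_W: "set W = strings a b False 2"
    using W by (auto simp: spanning_path_def)
  have "successively adj E"
    unfolding E_def
    by (rule successively_snake[OF symp_adj])
       (auto simp: e hd_e last_e adj_e intro!: successively_upt)
  moreover have "successively adj D"
    unfolding D_def using adj_W W
    by (intro successively_snake[OF symp_adj])
       (auto simp: hd_map last_map successively_map intro!: successively_upt)
  moreover have "successively adj (T z)" for z
    unfolding T_def
  proof (rule successively_snake[OF symp_adj])
    show "\<forall>w\<in>set W. M z w \<noteq> [] \<and> successively adj (M z w)"
      using M by (auto simp: M_def successively_map intro!: successively_upt)
  qed (use adj_W in \<open>simp add: M last_M\<close>)
  moreover have "a \<noteq> 1 \<Longrightarrow> a - 1 = Suc (a - Suc (Suc 0))"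
    using ab by simp
  \<comment> \<open>The seams are \<open>[0, a, 0]\<close> to \<open>[0, a - 1, 0]\<close> and
    \<open>[a - 2, a - 1, 0]\<close> to \<open>[a - 1, a - 1, 0]\<close>; for \<open>a = 1\<close>
    the list \<open>D\<close> is empty and \<open>E\<close> meets \<open>T z\<close>
    directly.\<close>
  ultimately have path: "successively adj (E @ D @ T z)" for z
    using E T last_E D_empty hd_D last_D ab
    by (cases "a = 1") (auto simp: successively_append_iff)
  have dist_E: "distinct E"
    unfolding E_def by (rule distinct_snake) (auto simp: e_def distinct_map inj_on_def)
  have dist_D: "distinct D"
    unfolding D_def using dist_W
    by (intro distinct_snake) (auto simp: distinct_map inj_on_def)
  have dist_T: "distinct (T z)" for z
    unfolding T_def using dist_W
    by (intro distinct_snake) (auto simp: M_def distinct_map inj_on_def)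
  have in_W: "w \<in> set W \<longleftrightarrow>
      (\<exists>q r. w = [q, r] \<and> q < a \<and> r < (if q = 0 then a + b else a))" for w
    by (auto simp: set_W numeral_2_eq_2 in_strings_Suc)
  have set_D: "x \<in> set D \<longleftrightarrow> (\<exists>p w. x = p # w \<and> p < a - 1 \<and> w \<in> set W)" for x
    by (auto simp: D_def)
  have set_T: "x \<in> set (T z) \<longleftrightarrow> (\<exists>p w. x = p # w \<and> a - 1 \<le> p \<and>
      p < (if z then a + b else a) \<and> w \<in> set W)" for x z
    by (auto simp: T_def M_def image_iff Bex_def)
  have set_E: "x \<in> set E \<longleftrightarrow> (\<exists>s r. x = [0, s, r] \<and> a \<le> s \<and> s < a + b \<and> r < a)" for x
    by (auto simp: E_def e_def image_iff Bex_def)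
  \<comment> \<open>Middle letters separate \<open>E\<close> from the rest, first letters separate
    \<open>D\<close> from \<open>T z\<close>.\<close>
  have "set E \<inter> (set D \<union> set (T z)) = {}" "set D \<inter> set (T z) = {}" for z
    by (auto simp: set_D set_T set_E in_W)
  then have dist: "distinct (E @ D @ T z)" for z
    using dist_E dist_D dist_T by simp
  have set: "set (E @ D @ T z) = strings a b z 3" for z
  proof (rule set_eqI)
    fix x
    have "x \<in> strings a b z 3 \<longleftrightarrow>
      (\<exists>p q r. x = [p, q, r] \<and> p < (if z then a + b else a) \<and>
        q < (if p = 0 then a + b else a) \<and> r < (if q = 0 then a + b else a))"
      unfolding numeral_3_eq_3 by (cases x; cases "tl x"; cases "tl (tl x)") (auto simp: strings_def)
    moreover have "x \<in> set (E @ D @ T z) \<longleftrightarrow>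
      (\<exists>p q r. x = [p, q, r] \<and> (p < (if z then a + b else a) \<and>
        q < a \<and> r < (if q = 0 then a + b else a) \<or> p = 0 \<and> a \<le> q \<and> q < a + b \<and> r < a))"
    proof -
      have "x \<in> set (D @ T z) \<longleftrightarrow>
        (\<exists>p w. x = p # w \<and> p < (if z then a + b else a) \<and> w \<in> set W)"
        using ab by (auto simp: set_D set_T)
      then show ?thesis
        unfolding set_append Un_iff set_E in_W by blast
    qed
    ultimately show "x \<in> set (E @ D @ T z) \<longleftrightarrow> x \<in> strings a b z 3"
      using ab by (cases x; cases "tl x"; cases "tl (tl x)") auto
  qed
  have "spanning_path (strings a b z 3) (hd E # tl E @ D @ T z)" for z
    using E path[of z] dist[of z] set[of z] by (cases E) (auto simp: spanning_path_def)
  \<comment> \<open>\<open>T z\<close> matters here only if \<open>tl E\<close> and \<open>D\<close>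
    are empty, and then only through its head, which is the same for both flags.\<close>
  moreover have "hd (tl E @ D @ T z) = hd (tl E @ D @ [[a - 1, a - 1, 0]])" for z
    using T by (auto simp: hd_append)
  moreover have "tl E @ D @ T z \<noteq> []" "last (tl E @ D @ T z) = (a - 1) # last W" for z
    using T by auto
  ultimately have "\<forall>z. spanning_path (strings a b z 3) (hd E # tl E @ D @ T z) \<and>
      tl E @ D @ T z \<noteq> [] \<and> hd (tl E @ D @ T z) = hd (tl E @ D @ [[a - 1, a - 1, 0]]) \<and>
      last (tl E @ D @ T z) = (a - 1) # last W"
    by blast
  then show ?thesis
    by (intro exI)
qed

section \<open>Lengthening the strings by three letters\<close>

lemma closed_path_extend:
  assumes odd: "odd a" "odd b" and "0 < n"
    and X: "spanning_path (strings a b False n) X" "X \<noteq> []" "even (length X)"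
  obtains C where "spanning_path (strings a b False (n + 3)) C" "adj (last C) (hd C)"
    "3 \<le> length C"
proof -
  obtain q U h l where U: "\<And>z. spanning_path (strings a b z 3) (q # U z)" "\<And>z. U z \<noteq> []"
    "\<And>z. hd (U z) = h" "\<And>z. last (U z) = l"
    using spanning_paths_length_3[OF odd] by metis
  define F where "F = (\<lambda>x. map (\<lambda>y. x @ y) (U (last x = 0)))"
  define C where "C = map (\<lambda>x. x @ q) X @ snake F (rev X)"
  have F: "F x \<noteq> []" "hd (F x) = x @ h" "last (F x) = x @ l" for x
    using U by (auto simp: F_def hd_map last_map)
  \<comment> \<open>As \<open>X\<close> has even length, the fiber over \<open>hd X\<close>, visited
    last, runs backward and ends at its head, adjacent to the start \<open>hd X @ q\<close> of
    \<open>C\<close>.\<close>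
  have S: "snake F (rev X) \<noteq> []" "hd (snake F (rev X)) = last X @ h"
    "last (snake F (rev X)) = hd X @ h"
    using X F by (auto simp: snake_eq_Nil_iff hd_snake last_snake hd_rev last_rev)
  have adj_U: "successively adj (U z)" and q_h: "adj q h"
    and dist_U: "distinct (U z)" "q \<notin> set (U z)"
    and set_U: "insert q (set (U z)) = strings a b z 3" for z
    using U(1)[of z] U(2)[of z] U(3)[of z] by (auto simp: spanning_path_def successively_Cons)
  have adj_X: "successively adj X" and dist_X: "distinct X" and set_X: "set X = strings a b False n"
    using X by (auto simp: spanning_path_def)
  have len: "length x = n" if "x \<in> set X" for x
    using that by (auto simp: set_X strings_def)
  have "successively adj (snake F (rev X))"
  proof (rule successively_snake[OF symp_adj])
    show "\<forall>x\<in>set (rev X). F x \<noteq> [] \<and> successively adj (F x)"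
      using adj_U F by (simp add: F_def successively_map)
    \<comment> \<open>Neighbouring fibers may use different lists \<open>U\<close>, but these share
      the end suffixes \<open>h\<close> and \<open>l\<close>.\<close>
    show "successively (\<lambda>x y. adj (hd (F x)) (hd (F y)) \<and> adj (last (F x)) (last (F y))) (rev X)"
      unfolding successively_rev
      by (rule successively_mono[OF adj_X]) (auto simp: F intro: adj_append_right adj_sym)
  qed
  moreover have "successively adj (map (\<lambda>x. x @ q) X)"
    unfolding successively_map
    by (rule successively_mono[OF adj_X]) (auto intro: adj_append_right)
  ultimately have "successively adj C"
    using X S q_h by (auto simp: C_def successively_append_iff last_map)
  moreover have "distinct (snake F (rev X))"
    using dist_X dist_U len by (intro distinct_snake) (auto simp: F_def distinct_map inj_on_def)
  then have "distinct C"
    using dist_X dist_U len by (auto simp: C_def F_def distinct_map inj_on_def)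
  moreover have "set C = strings a b False (n + 3)"
  proof (rule set_eqI)
    fix w
    have "w \<in> set C \<longleftrightarrow> (\<exists>x\<in>set X. \<exists>y\<in>insert q (set (U (last x = 0))). w = x @ y)"
      by (auto simp: C_def F_def)
    also have "\<dots> \<longleftrightarrow> (\<exists>x\<in>strings a b False n. \<exists>y\<in>strings a b (last x = 0) 3. w = x @ y)"
      by (simp only: set_X set_U)
    also have "\<dots> \<longleftrightarrow> w \<in> strings a b False (n + 3)"
    proof
      assume "w \<in> strings a b False (n + 3)"
      \<comment> \<open>Positive \<open>n\<close> makes the prefix nonempty, so that its
        \<open>last\<close> is the letter preceding the suffix.\<close>
      moreover from this have "take n w \<noteq> []"
        using \<open>0 < n\<close> by (auto simp: strings_def)
      ultimately have "take n w \<in> strings a b False n"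
        "drop n w \<in> strings a b (last (take n w) = 0) 3"
        using admissible_append[of "take n w" a b False "drop n w"] by (auto simp: strings_def)
      then show "\<exists>x\<in>strings a b False n. \<exists>y\<in>strings a b (last x = 0) 3. w = x @ y"
        by (metis append_take_drop_id)
    qed (use \<open>0 < n\<close> in \<open>force simp: strings_def admissible_append\<close>)
    finally show "w \<in> set C \<longleftrightarrow> w \<in> strings a b False (n + 3)" .
  qed
  ultimately have "spanning_path (strings a b False (n + 3)) C"
    by (simp add: spanning_path_def)
  moreover have "adj (last C) (hd C)"
    using S X q_h by (auto simp: C_def hd_append hd_map intro: adj_sym)
  moreover have "3 \<le> length C"
  proof -
    have "2 \<le> length X"
      using X by (cases X rule: remdups_adj.cases) auto
    moreover have "1 \<le> length (snake F (rev X))"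
      using S by (simp add: Suc_le_eq)
    ultimately show ?thesis
      by (simp add: C_def)
  qed
  ultimately show ?thesis
    using that by blast
qed

lemma spanning_path_even:
  assumes "odd a" "odd b"
  obtains X where "spanning_path (strings a b False (3 * m + 2)) X" "X \<noteq> []" "even (length X)"
proof -
  have "\<exists>X. spanning_path (strings a b False (3 * m + 2)) X \<and> X \<noteq> [] \<and> even (length X)"
  proof (induction m)
    case 0
    obtain W where "spanning_path (strings a b False 2) W" "W \<noteq> []" "even (length W)"
      using spanning_path_length_2[OF assms] .
    then show ?case
      unfolding mult_0_right add_0 by blast
  next
    case (Suc m)
    then obtain X where "spanning_path (strings a b False (3 * m + 2)) X" "X \<noteq> []" "even (length X)"
      by blast
    then obtain C where C: "spanning_path (strings a b False (3 * m + 2 + 3)) C"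
      "adj (last C) (hd C)" "3 \<le> length C"
      using closed_path_extend[OF assms, of "3 * m + 2" X] by auto
    \<comment> \<open>The closing edge joins opposite colours, so the cycle opened there is an even
      path for the next round.\<close>
    then have "even (length C)"
      using even_length_path[of C] adj_parity[of "last C" "hd C"]
      by (cases "C = []") (auto simp: spanning_path_def)
    with C show ?case
      by (intro exI[of _ C]) (auto simp: algebra_simps)
  qed
  then show ?thesis
    using that by blast
qed

theorem theorem17:
  fixes a b n k :: nat
  assumes "a \<ge> 1" and "b \<ge> 1" and "odd a" and "odd b"
    and "k \<ge> 2" and "n = 3 * k - 1"
  shows "hamiltonian (horadam_cube a b n)"
proof -
  \<comment> \<open>One extension is kept for the end, since it supplies the closing edge;
    \<open>k \<ge> 2\<close> makes the dimension \<open>n - 3\<close> before it at least 2.\<close>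
  define m where "m = k - 2"
  have n: "n = 3 * m + 2 + 3"
    using assms by (simp add: m_def)
  obtain X where "spanning_path (strings a b False (3 * m + 2)) X" "X \<noteq> []" "even (length X)"
    using spanning_path_even[OF assms(3,4)] .
  then obtain C where "spanning_path (strings a b False n) C" "adj (last C) (hd C)" "3 \<le> length C"
    using closed_path_extend[OF assms(3,4), of "3 * m + 2"] by (auto simp: n)
  then show ?thesis
    by (intro hamiltonianI) (auto simp: horadam_strings_eq)
qed

end
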